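(* For all non-negative integers $n,k,\ell$, the number of basis partitions $\lambda=(k+\ell,\pi,\sigma)$ of $n$ (i.e. basis partitions of $n$ with Durfee square of side $k+\ell$) such that $\pi$ has exactly $\ell$ distinct part sizes equals $L_2(n,k,\ell)$.
   Context: For an ordinary partition $\lambda=\lambda_1\ge\lambda_2\ge\cdots$, its Durfee square has side $d$, where $d$ is the largest integer $i$ with $\lambda_i\ge i$ ($d=0$ for the empty partition). Writing $\lambda'$ for the conjugate partition, $\lambda$ is represented by the triple $(d,\pi,\sigma)$ where $\pi=\lambda_{d+1}+\lambda_{d+2}+\cdots$ and $\sigma=\lambda'_{d+1}+\lambda'_{d+2}+\cdots$; then $|\lambda|=d^2+|\pi|+|\sigma|$. A partition $\lambda=(d,\pi,\sigma)$ is a basis partition if $\pi$ and $\sigma$ have no part size in common. A two-color partition is a partition each of whose parts is colored red or green. $\mathcal{L}_2(n)$ is the set of two-color partitions $\lambda_1>\lambda_2>\cdots>\lambda_m$ of $n$ into numerically distinct parts such that each red part $\lambda_i$ with $i<m$ satisfies $\lambda_i-\lambda_{i+1}\ge 2$, each green part $\lambda_i$ with $i<m$ satisfies $\lambda_i-\lambda_{i+1}\ge 3$, and no part equals $1$ with green color. $L_2(n,k,\ell)$ is the number of partitions in $\mathcal{L}_2(n)$ with exactly $k$ red and $\ell$ green parts. *)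

theory Defs
  imports Main
begin

text \<open>A partition is the weakly decreasing list of its positive parts, so each partition
  of \<open>n\<close> is represented by exactly one list.\<close>

definition partitions :: "nat \<Rightarrow> nat list set" where
  "partitions n = {lam. sorted_wrt (\<ge>) lam \<and> (\<forall>p\<in>set lam. 0 < p) \<and> sum_list lam = n}"

text \<open>\<open>part lam i\<close> is $\lambda_i$, with indices starting at 1 and the value 0 past the last
  part. The junk value at index 0 is also 0.\<close>

definition part :: "nat list \<Rightarrow> nat \<Rightarrow> nat" where
  "part lam i = (if 1 \<le> i \<and> i \<le> length lam then lam ! (i - 1) else 0)"

definition conjugate :: "nat list \<Rightarrow> nat list" where
  "conjugate lam = map (\<lambda>j. length (filter (\<lambda>p. j \<le> p) lam)) [1..<Suc (part lam 1)]"

text \<open>The set always contains 0 and is bounded by the length of \<open>lam\<close>, so the maximum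
  exists and is 0 for the empty partition.\<close>

definition durfee :: "nat list \<Rightarrow> nat" where
  "durfee lam = Max {i. i \<le> part lam i}"

text \<open>The components \<open>\<pi>\<close> and \<open>\<sigma>\<close> of the representation \<open>(d, \<pi>, \<sigma>)\<close>.\<close>

definition durfee_pi :: "nat list \<Rightarrow> nat list" where
  "durfee_pi lam = drop (durfee lam) lam"

definition durfee_sigma :: "nat list \<Rightarrow> nat list" where
  "durfee_sigma lam = drop (durfee lam) (conjugate lam)"

definition basis_partitions :: "nat \<Rightarrow> nat list set" where
  "basis_partitions n =
    {lam \<in> partitions n. set (durfee_pi lam) \<inter> set (durfee_sigma lam) = {}}"

datatype color = Red | Green

text \<open>The colored parts are listed in strictly decreasing order of size, which is a canonical
  order because the parts are numerically distinct.\<close>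

definition L2_set :: "nat \<Rightarrow> (nat \<times> color) list set" where
  "L2_set n = {ps.
     sorted_wrt (>) (map fst ps) \<and> (\<forall>p\<in>set ps. 0 < fst p) \<and> sum_list (map fst ps) = n \<and>
     (\<forall>i. Suc i < length ps \<longrightarrow>
        (snd (ps ! i) = Red \<longrightarrow> fst (ps ! i) \<ge> fst (ps ! Suc i) + 2) \<and>
        (snd (ps ! i) = Green \<longrightarrow> fst (ps ! i) \<ge> fst (ps ! Suc i) + 3)) \<and>
     (1, Green) \<notin> set ps}"

definition L2 :: "nat \<Rightarrow> nat \<Rightarrow> nat \<Rightarrow> nat" where
  "L2 n k l = card {ps \<in> L2_set n.
     length (filter (\<lambda>p. snd p = Red) ps) = k \<and> length (filter (\<lambda>p. snd p = Green) ps) = l}"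

end

theory Submission
  imports Defs
begin

text \<open>The bijection sends a basis partition to the list of its principal hook lengths
  $\lambda_j + \lambda'_j - 2j + 1$ for $1 \le j \le d$, the \<open>j\<close>-th of them being green exactly
  when \<open>j\<close> is a part size of \<open>\<pi>\<close>. Consecutive hook lengths differ by 2 plus the
  multiplicities of \<open>j\<close> in \<open>\<pi>\<close> and in \<open>\<sigma>\<close>. For a basis partition at most one of the two
  is nonzero, and the color tells which one, so the hook lengths determine the partition.
  Everything is done by induction, removing the first row and column of the diagram.\<close>

lemma part_Nil [simp]: "part [] i = 0"
  by (simp add: part_def)

lemma part_Cons_1 [simp]: "part (a # as) (Suc 0) = a"
  by (simp add: part_def)

lemma sorted_ge_Cons_part:
  "sorted_wrt (\<ge>) (a # as) \<longleftrightarrow> part as 1 \<le> a \<and> sorted_wrt (\<ge>) (as :: nat list)"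
  by (cases as) auto

subsection \<open>Durfee decomposition\<close>

text \<open>The partition with Durfee square of side \<open>length as\<close>, with row \<open>j\<close> extending
  \<open>as ! (j - 1)\<close> cells to the right of the square, and with \<open>bs\<close> below the square.\<close>

definition assemble :: "nat list \<Rightarrow> nat list \<Rightarrow> nat list" where
  "assemble as bs = map ((+) (length as)) as @ bs"

text \<open>These are the column lengths of the diagram with rows \<open>as\<close>, hence the part
  sizes of \<sigma>; rows of length 0 do no harm, as only columns from 1 on are counted.\<close>

definition conj_parts :: "nat list \<Rightarrow> nat set" where
  "conj_parts as = (\<lambda>j. length (filter ((\<le>) j) as)) ` {1..part as 1}"

text \<open>Zeros are allowed in \<open>as\<close>, so that its length records the side of the
  Durfee square, but not in \<open>bs\<close>, which is \<pi> itself.\<close>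

definition basis_pair :: "nat list \<Rightarrow> nat list \<Rightarrow> bool" where
  "basis_pair as bs \<longleftrightarrow> sorted_wrt (\<ge>) as \<and> sorted_wrt (\<ge>) bs \<and>
     set bs \<subseteq> {1..length as} \<and> set bs \<inter> conj_parts as = {}"

text \<open>The bound on \<open>bs\<close> is what keeps the square from growing: every row below it
  has at most \<open>length as\<close> cells.\<close>

lemma durfee_assemble:
  assumes "set bs \<subseteq> {1..length as}"
  shows "durfee (assemble as bs) = length as"
proof -
  let ?lam = "assemble as bs" and ?d = "length as"
  have "i \<le> part ?lam i \<longleftrightarrow> i \<le> ?d" for i
  proof (cases "i \<le> ?d")
    case True
    then show ?thesis
      by (auto simp: part_def assemble_def nth_append)
  next
    case False
    have "part ?lam i \<le> ?d"
    proof (cases "i \<le> length ?lam")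
      case True
      then have "part ?lam i = bs ! (i - 1 - ?d)" "i - 1 - ?d < length bs"
        using False by (auto simp: part_def assemble_def nth_append)
      then show ?thesis
        using assms nth_mem by fastforce
    qed (simp add: part_def)
    with False show ?thesis by simp
  qed
  then have "{i. i \<le> part ?lam i} = {..?d}" by auto
  then show ?thesis
    unfolding durfee_def by (simp add: Max_eq_iff)
qed

lemma durfee_pi_assemble:
  "set bs \<subseteq> {1..length as} \<Longrightarrow> durfee_pi (assemble as bs) = bs"
  by (simp add: durfee_pi_def durfee_assemble) (simp add: assemble_def)

text \<open>Rows in \<open>bs\<close> are too short to reach past the square, so column
  \<open>?d + j\<close> of the whole diagram is column \<open>j\<close> of
  \<open>as\<close>.\<close>

lemma set_durfee_sigma_assemble:
  assumes "set bs \<subseteq> {1..length as}"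
  shows "set (durfee_sigma (assemble as bs)) = conj_parts as"
proof (cases as)
  case Nil
  with assms have "bs = []" by auto
  with Nil show ?thesis
    by (simp add: durfee_sigma_def conjugate_def assemble_def conj_parts_def)
next
  case (Cons a as')
  let ?lam = "assemble as bs" and ?d = "length as"
  have part1: "part ?lam 1 = ?d + a"
    using Cons by (simp add: assemble_def)
  have filter: "length (filter ((\<le>) (?d + j)) ?lam) = length (filter ((\<le>) j) as)"
    if "1 \<le> j" for j
  proof -
    have "filter ((\<le>) (?d + j)) bs = []"
      using assms that by (fastforce simp: filter_empty_conv)
    then show ?thesis
      by (simp add: assemble_def filter_map o_def)
  qed
  have "set (durfee_sigma ?lam) =
      (\<lambda>j. length (filter ((\<le>) j) ?lam)) ` {Suc ?d..?d + a}"
    unfolding durfee_sigma_def conjugate_def durfee_assemble[OF assms] part1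
    by (simp add: drop_map atLeastLessThanSuc_atLeastAtMost del: upt_Suc)
  also have "{Suc ?d..?d + a} = (+) ?d ` {1..a}"
    by (simp add: image_add_atLeastAtMost)
  also have "(\<lambda>j. length (filter ((\<le>) j) ?lam)) ` (+) ?d ` {1..a} =
      (\<lambda>j. length (filter ((\<le>) j) as)) ` {1..a}"
    unfolding image_image using filter by (intro image_cong) auto
  finally show ?thesis
    using Cons by (simp add: conj_parts_def)
qed

lemma sum_list_map_add_const:
  "sum_list (map ((+) (c :: nat)) xs) = c * length xs + sum_list xs"
  by (induction xs) auto

lemma sum_list_assemble:
  "sum_list (assemble as bs) = (length as)^2 + sum_list as + sum_list bs"
  by (simp add: assemble_def sum_list_map_add_const power2_eq_square)

lemma assemble_in_basis_partitions:
  assumes "basis_pair as bs"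
  shows "assemble as bs \<in> basis_partitions (sum_list (assemble as bs))"
proof -
  have bs: "set bs \<subseteq> {1..length as}"
    using assms by (simp add: basis_pair_def)
  have "sorted_wrt (\<ge>) (assemble as bs)" "\<forall>p\<in>set (assemble as bs). 0 < p"
    using assms by (fastforce simp: basis_pair_def assemble_def sorted_wrt_append sorted_wrt_map)+
  then show ?thesis
    using assms bs
    by (simp add: basis_partitions_def partitions_def durfee_pi_assemble
        set_durfee_sigma_assemble basis_pair_def)
qed

lemma basis_partition_assemble:
  assumes "lam \<in> basis_partitions n"
  obtains as bs where "basis_pair as bs" "lam = assemble as bs"
proof -
  define d where "d = durfee lam"
  define as where "as = map (\<lambda>x. x - d) (take d lam)"
  define bs where "bs = drop d lam"
  have sorted: "sorted_wrt (\<ge>) lam" and pos: "\<forall>p\<in>set lam. 0 < p"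
    using assms by (auto simp: basis_partitions_def partitions_def)
  let ?I = "{i. i \<le> part lam i}"
  \<comment> \<open>Since \<open>part\<close> is 0 past the last row, the maximum defining
    \<open>d\<close> is attained. Membership of \<open>d\<close> bounds row \<open>d\<close> from
    below, and non-membership of \<open>Suc d\<close> bounds the next row, \<open>lam ! d\<close>,
    from above.\<close>
  have "?I \<subseteq> {..length lam}"
    by (auto simp: part_def split: if_splits)
  then have fin: "finite ?I"
    using finite_subset by blast
  have "0 \<in> ?I" by simp
  then have "d \<in> ?I"
    unfolding d_def durfee_def using Max_in[OF fin] by blast
  then have d: "d \<le> length lam" and d_le: "d = 0 \<or> d \<le> lam ! (d - 1)"
    by (auto simp: part_def split: if_splits)
  have "Suc d \<notin> ?I"
    using Max_ge[OF fin, of "Suc d"] unfolding d_def durfee_def by auto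
  then have Suc_d: "d < length lam \<Longrightarrow> lam ! d \<le> d"
    by (auto simp: part_def)
  have nth_mono: "lam ! j \<le> lam ! i" if "i \<le> j" "j < length lam" for i j
    using sorted_wrt_nth_less[OF sorted, of i j] that by (cases "i = j") auto
  have len: "length as = d"
    using d by (simp add: as_def)
  have top: "d \<le> x" if x: "x \<in> set (take d lam)" for x
  proof -
    obtain i where "i < d" "x = lam ! i"
      using x by (auto simp: in_set_conv_nth)
    then show ?thesis
      using d d_le nth_mono[of i "d - 1"] by (auto simp: Suc_le_eq intro: le_trans)
  qed
  then have "map ((+) d) as = take d lam"
    by (auto simp: as_def intro: map_idI)
  then have lam: "lam = assemble as bs"
    by (simp add: assemble_def len bs_def)
  have bs: "set bs \<subseteq> {1..length as}"
  proof
    fix x assume x: "x \<in> set bs"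
    then obtain i where "i < length lam - d" "x = lam ! (d + i)"
      by (auto simp: bs_def in_set_conv_nth)
    then have "x \<le> d"
      using nth_mono[of d "d + i"] Suc_d by fastforce
    moreover have "0 < x"
      using x pos by (auto simp: bs_def dest: in_set_dropD)
    ultimately show "x \<in> {1..length as}"
      by (simp add: len)
  qed
  have "sorted_wrt (\<ge>) as" "sorted_wrt (\<ge>) bs"
    using sorted unfolding lam assemble_def by (auto simp: sorted_wrt_append sorted_wrt_map)
  moreover have "set bs \<inter> conj_parts as = {}"
    using assms unfolding lam basis_partitions_def
    by (simp add: durfee_pi_assemble[OF bs] set_durfee_sigma_assemble[OF bs])
  ultimately have "basis_pair as bs"
    using bs by (simp add: basis_pair_def)
  with lam that show ?thesis by blast
qed

text \<open>Injectivity rests on the fixed length \<open>d\<close> of \<open>as\<close>: it fixes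
  where the list splits and how much was added to each row.\<close>

lemma bij_betw_assemble:
  "bij_betw (\<lambda>(as, bs). assemble as bs)
     {(as, bs). basis_pair as bs \<and> length as = d \<and> card (set bs) = l \<and>
        sum_list (assemble as bs) = n}
     {lam \<in> basis_partitions n. durfee lam = d \<and> card (set (durfee_pi lam)) = l}"
  (is "bij_betw ?f ?A ?B")
  unfolding bij_betw_def
proof
  have sub: "set bs \<subseteq> {1..length as}" if "basis_pair as bs" for as bs
    using that by (simp add: basis_pair_def)
  show "inj_on ?f ?A"
  proof (rule inj_onI, clarify)
    fix as bs as' bs'
    assume len: "length as = length as'" and eq: "assemble as' bs' = assemble as bs"
    show "as' = as \<and> bs' = bs"
      using eq by (simp add: assemble_def len inj_map_eq_map)
  qed
  show "?f ` ?A = ?B"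
  proof
    show "?f ` ?A \<subseteq> ?B"
      using assemble_in_basis_partitions
      by (auto simp: durfee_assemble[OF sub] durfee_pi_assemble[OF sub])
    show "?B \<subseteq> ?f ` ?A"
    proof
      fix lam assume lam: "lam \<in> ?B"
      then obtain as bs where *: "basis_pair as bs" "lam = assemble as bs"
        using basis_partition_assemble by blast
      have "sum_list lam = n"
        using lam by (simp add: basis_partitions_def partitions_def)
      with lam * have "(as, bs) \<in> ?A"
        by (simp add: durfee_assemble[OF sub] durfee_pi_assemble[OF sub])
      with * show "lam \<in> ?f ` ?A" by force
    qed
  qed
qed

subsection \<open>Removing the first row and column\<close>

text \<open>A new top row lengthens every old column by one; the columns past
  \<open>part as 1\<close> meet only the new row and have length 1.\<close>

lemma conj_parts_Cons:
  assumes "sorted_wrt (\<ge>) (a # as)"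
  shows "conj_parts (a # as) = Suc ` conj_parts as \<union> (if part as 1 < a then {1} else {})"
proof -
  let ?f = "\<lambda>as j. length (filter ((\<le>) j) as)"
  have le: "part as 1 \<le> a"
    using assms sorted_ge_Cons_part by blast
  have short: "x \<le> part as 1" if "x \<in> set as" for x
    using assms that by (cases as) auto
  have "{1..a} = {1..part as 1} \<union> {Suc (part as 1)..a}"
    using le by auto
  then have "conj_parts (a # as) = ?f (a # as) ` {1..part as 1} \<union> ?f (a # as) ` {Suc (part as 1)..a}"
    by (simp add: conj_parts_def image_Un)
  also have "?f (a # as) ` {1..part as 1} = Suc ` conj_parts as"
    unfolding conj_parts_def image_image using le by (intro image_cong) auto
  also have "?f (a # as) ` {Suc (part as 1)..a} = (\<lambda>_. 1) ` {Suc (part as 1)..a}"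
  proof (rule image_cong[OF refl])
    fix j assume j: "j \<in> {Suc (part as 1)..a}"
    then have "filter ((\<le>) j) as = []"
      using short by (fastforce simp: filter_empty_conv)
    then show "?f (a # as) j = 1"
      using j by simp
  qed
  also have "\<dots> = (if part as 1 < a then {1} else {})"
    by (simp add: image_constant_conv)
  finally show ?thesis .
qed

lemma basis_pair_Nil: "basis_pair [] bs \<longleftrightarrow> bs = []"
  by (auto simp: basis_pair_def conj_parts_def)

lemma zero_notin_conj_parts:
  "sorted_wrt (\<ge>) as \<Longrightarrow> 0 \<notin> conj_parts as"
  by (cases as) (auto simp: conj_parts_def)

lemma basis_pair_pos: "basis_pair as bs \<Longrightarrow> 0 \<notin> set bs"
  by (auto simp: basis_pair_def)

text \<open>Old sizes on both sides shift by one, so only size 1 can create a new clash. It occurs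
  below the square when \<open>p > 0\<close> and to the right when \<open>part as 1 < a\<close>, and
  these must not happen together.\<close>

lemma basis_pair_Cons:
  assumes "0 \<notin> set bs"
  shows "basis_pair (a # as) (map Suc bs @ replicate p 1) \<longleftrightarrow>
     basis_pair as bs \<and> part as 1 \<le> a \<and> (p = 0 \<or> a = part as 1)"
proof (cases "sorted_wrt (\<ge>) (a # as)")
  case True
  have s: "sorted_wrt (\<ge>) as" "part as 1 \<le> a"
    using True sorted_ge_Cons_part by blast+
  have pos: "\<forall>x\<in>set bs. 0 < x"
    using assms by (metis gr0I)
  have "sorted_wrt (\<ge>) (replicate p (1 :: nat))"
    by (induction p) simp_all
  then have "sorted_wrt (\<ge>) (map Suc bs @ replicate p 1) \<longleftrightarrow> sorted_wrt (\<ge>) bs"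
    by (simp add: sorted_wrt_append sorted_wrt_map set_replicate_conv_if)
  moreover have "set (map Suc bs @ replicate p 1) \<subseteq> {1..length (a # as)} \<longleftrightarrow>
      set bs \<subseteq> {1..length as}"
    using pos by (auto simp: subset_eq ball_Un image_iff Suc_le_eq)
  moreover have "set (map Suc bs @ replicate p 1) \<inter> conj_parts (a # as) = {} \<longleftrightarrow>
      set bs \<inter> conj_parts as = {} \<and> (p = 0 \<or> a = part as 1)"
    using assms s zero_notin_conj_parts[OF s(1)] unfolding conj_parts_Cons[OF True]
    by (auto simp: set_replicate_conv_if)
  ultimately show ?thesis
    using True s unfolding basis_pair_def by blast
next
  case False
  then show ?thesis
    unfolding basis_pair_def sorted_ge_Cons_part by blast
qed

text \<open>Rows of length 1 disappear with the column; the filter also makes the result positive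
  for every input.\<close>

definition drop_column :: "nat list \<Rightarrow> nat list" where
  "drop_column bs = map (\<lambda>x. x - 1) (filter (\<lambda>x. 1 < x) bs)"

lemma drop_column_pos: "0 \<notin> set (drop_column bs)"
  by (auto simp: drop_column_def)

lemma drop_column_Suc:
  "0 \<notin> set bs \<Longrightarrow> drop_column (map Suc bs @ replicate p (Suc 0)) = bs"
  by (induction bs) (auto simp: drop_column_def)

lemma Suc_drop_column:
  assumes "sorted_wrt (\<ge>) bs" "0 \<notin> set bs"
  shows "map Suc (drop_column bs) @ replicate (count_list bs 1) 1 = bs"
  using assms
proof (induction bs)
  case Nil
  then show ?case by (simp add: drop_column_def)
next
  case (Cons b bs)
  show ?case
  proof (cases "b = 1")
    case True
    \<comment> \<open>All later parts are positive and at most 1, so the ones form the tail of the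
      list.\<close>
    then have "drop_column bs = []"
      using Cons.prems by (auto simp: drop_column_def filter_empty_conv)
    with Cons True show ?thesis
      by (simp add: drop_column_def)
  next
    case False
    with Cons show ?thesis
      by (simp add: drop_column_def)
  qed
qed

subsection \<open>Colored hook lengths\<close>

text \<open>The corner hook has arm \<open>a + length as\<close>, leg
  \<open>length bs + length as\<close> and one corner cell. After \<open>j - 1\<close> columns are
  dropped, an original part \<open>j\<close> has become 1, so the test for 1 detects the size
  \<open>j\<close>.\<close>

fun hooks :: "nat list \<Rightarrow> nat list \<Rightarrow> (nat \<times> color) list" where
  "hooks [] bs = []"
| "hooks (a # as) bs =
     (a + length bs + 2 * length as + 1, if 1 \<in> set bs then Green else Red) #
     hooks as (drop_column bs)"

text \<open>Here \<open>e\<close> is the excess of \<open>m\<close> over the smallest hook that fits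
  around the inner diagram; red puts it into the first row, green into parts equal to 1.\<close>

fun unhooks :: "(nat \<times> color) list \<Rightarrow> nat list \<times> nat list" where
  "unhooks [] = ([], [])"
| "unhooks ((m, c) # ps) =
     (let (as, bs) = unhooks ps;
          e = m - (part as 1 + length bs + 2 * length as + 1)
      in case c of
           Red \<Rightarrow> ((part as 1 + e) # as, map Suc bs)
         | Green \<Rightarrow> (part as 1 # as, map Suc bs @ replicate e 1))"

text \<open>This is the least red part that may precede \<open>ps\<close>; a green one must be
  strictly larger. The value 1 for the empty list encodes both positivity and the ban on a green
  1.\<close>

fun room :: "(nat \<times> color) list \<Rightarrow> nat" where
  "room [] = 1"
| "room ((m, c) # ps) = m + 2"

fun gapped :: "(nat \<times> color) list \<Rightarrow> bool" where
  "gapped [] \<longleftrightarrow> True"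
| "gapped ((m, c) # ps) \<longleftrightarrow> gapped ps \<and> (if c = Green then room ps < m else room ps \<le> m)"

lemma forall_nat_split: "(\<forall>i. P i) \<longleftrightarrow> P 0 \<and> (\<forall>i. P (Suc i))"
proof (intro iffI allI)
  fix i
  assume "P 0 \<and> (\<forall>i. P (Suc i))"
  then show "P i" by (cases i) auto
qed auto

lemma L2_set_iff_gapped:
  "ps \<in> L2_set n \<longleftrightarrow> gapped ps \<and> sum_list (map fst ps) = n"
proof -
  have "(sorted_wrt (>) (map fst ps) \<and> (\<forall>p\<in>set ps. 0 < fst p) \<and>
     (\<forall>i. Suc i < length ps \<longrightarrow>
        (snd (ps ! i) = Red \<longrightarrow> fst (ps ! i) \<ge> fst (ps ! Suc i) + 2) \<and>
        (snd (ps ! i) = Green \<longrightarrow> fst (ps ! i) \<ge> fst (ps ! Suc i) + 3)) \<and>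
     (1, Green) \<notin> set ps) \<longleftrightarrow> gapped ps" (is "?S ps \<and> ?P ps \<and> ?G ps \<and> ?N ps \<longleftrightarrow> _")
  proof (induction ps)
    case Nil
    show ?case by simp
  next
    case (Cons p ps)
    obtain m c where p: "p = (m, c)" by fastforce
    show ?case
    proof (cases ps)
      case Nil
      then show ?thesis using p by (cases c) auto
    next
      case (Cons q qs)
      obtain m' c' where q: "q = (m', c')" by fastforce
      \<comment> \<open>Index 0 compares the two leading parts; the shifted indices give the
        condition on the tail.\<close>
      have G: "?G (p # ps) \<longleftrightarrow> ?G ps \<and> (c = Red \<longrightarrow> m \<ge> m' + 2) \<and> (c = Green \<longrightarrow> m \<ge> m' + 3)"
        unfolding Cons p q by (subst forall_nat_split) auto
      have S: "?S (p # ps) \<longleftrightarrow> ?S ps \<and> m > m'"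
        unfolding Cons p q by auto
      show ?thesis
        unfolding G S using Cons.IH Cons
        by (cases c) (auto simp: p q)
    qed
  qed
  then show ?thesis
    unfolding L2_set_def by auto
qed

text \<open>This is \<open>basis_pair_Cons\<close> read backwards, with \<open>p\<close> the number
  of ones in \<open>bs\<close>.\<close>

lemma basis_pair_cases:
  assumes "basis_pair (a # as) bs"
  shows "basis_pair as (drop_column bs)" "part as 1 \<le> a"
    "count_list bs 1 = 0 \<or> a = part as 1"
    "map Suc (drop_column bs) @ replicate (count_list bs 1) 1 = bs"
proof -
  show eq: "map Suc (drop_column bs) @ replicate (count_list bs 1) 1 = bs"
    using assms basis_pair_pos by (intro Suc_drop_column) (auto simp: basis_pair_def)
  then have "basis_pair (a # as) (map Suc (drop_column bs) @ replicate (count_list bs 1) 1)"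
    using assms by simp
  then show "basis_pair as (drop_column bs)" "part as 1 \<le> a"
    "count_list bs 1 = 0 \<or> a = part as 1"
    using basis_pair_Cons[OF drop_column_pos] by blast+
qed

section \<open>Basis pairs correspond to gapped colored lists\<close>

lemma length_hooks [simp]: "length (hooks as bs) = length as"
  by (induction as bs rule: hooks.induct) auto

text \<open>The right side is the smallest hook that can surround the diagram: new row equal to
  \<open>part as 1\<close> and no new parts 1.\<close>

lemma room_hooks:
  "basis_pair as bs \<Longrightarrow> room (hooks as bs) = part as 1 + length bs + 2 * length as + 1"
  by (cases as) (auto simp: basis_pair_Nil)

lemma length_drop_column:
  assumes "basis_pair (a # as) bs"
  shows "length bs = length (drop_column bs) + count_list bs 1"
  using arg_cong[OF basis_pair_cases(4)[OF assms], of length] by simp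

text \<open>The outer hook exceeds this minimum by \<open>a - part as 1\<close> plus the number of
  ones in \<open>bs\<close>; green means that there are ones, whence the strict inequality.\<close>

lemma gapped_hooks: "basis_pair as bs \<Longrightarrow> gapped (hooks as bs)"
proof (induction as arbitrary: bs)
  case (Cons a as)
  note c = basis_pair_cases[OF Cons.prems]
  show ?case
    using Cons.IH[OF c(1)] c(2) room_hooks[OF c(1)] length_drop_column[OF Cons.prems]
      count_list_0_iff[of bs 1]
    by auto
qed simp

text \<open>At most one of the two contributions to the excess is nonzero, and the color tells
  which.\<close>

lemma unhooks_hooks: "basis_pair as bs \<Longrightarrow> unhooks (hooks as bs) = (as, bs)"
proof (induction as arbitrary: bs)
  case Nil
  then show ?case by (simp add: basis_pair_Nil)
next
  case (Cons a as)
  note c = basis_pair_cases[OF Cons.prems]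
  note IH = Cons.IH[OF c(1)]
  note len = length_drop_column[OF Cons.prems]
  show ?case
  proof (cases "1 \<in> set bs")
    case True
    then have "a = part as 1"
      using c(3) count_list_0_iff[of bs 1] by auto
    with True c(4) len show ?thesis
      by (simp add: IH Let_def)
  next
    case False
    then have "count_list bs 1 = 0"
      by (simp add: count_list_0_iff)
    with False c(2,4) len show ?thesis
      by (simp add: IH Let_def)
  qed
qed

lemma unhooks_correct:
  "gapped ps \<Longrightarrow> unhooks ps = (as, bs) \<Longrightarrow> basis_pair as bs \<and> hooks as bs = ps"
proof (induction ps arbitrary: as bs)
  case Nil
  then show ?case by (simp add: basis_pair_Nil)
next
  case (Cons p ps)
  obtain m c where p: "p = (m, c)" by fastforce
  obtain as' bs' where u: "unhooks ps = (as', bs')" by fastforce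
  have IH: "basis_pair as' bs'" "hooks as' bs' = ps"
    using Cons.IH[OF _ u] Cons.prems p by auto
  define r where "r = part as' 1 + length bs' + 2 * length as' + 1"
  have r: "room ps = r"
    using room_hooks[OF IH(1)] IH(2) by (simp add: r_def)
  note pos = basis_pair_pos[OF IH(1)]
  have d0: "drop_column (map Suc bs') = bs'"
    using drop_column_Suc[OF pos, of 0] by simp
  note iff = basis_pair_Cons[OF pos, of _ as']
  show ?case
  proof (cases c)
    case Red
    then have as: "as = (part as' 1 + (m - r)) # as'" and bs: "bs = map Suc bs'"
      using Cons.prems(2) by (auto simp: p u Let_def r_def)
    have "r \<le> m"
      using Cons.prems(1) Red r by (simp add: p)
    then have "hooks as bs = p # ps"
      using pos Red by (auto simp: as bs p d0 IH(2) r_def)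
    moreover have "basis_pair as bs"
      using iff[of "part as' 1 + (m - r)" 0] IH(1) by (simp add: as bs)
    ultimately show ?thesis by blast
  next
    case Green
    then have as: "as = part as' 1 # as'" and bs: "bs = map Suc bs' @ replicate (m - r) 1"
      using Cons.prems(2) by (auto simp: p u Let_def r_def)
    \<comment> \<open>Strictness puts at least one 1 into \<open>bs\<close>, so that
      \<open>hooks\<close> colors this part green again.\<close>
    have "r < m"
      using Cons.prems(1) Green r by (simp add: p)
    then have "hooks as bs = p # ps"
      using pos Green by (auto simp: as bs p drop_column_Suc[OF pos] IH(2) r_def)
    moreover have "basis_pair as bs"
      using iff[of "part as' 1" "m - r"] IH(1) by (simp add: as bs)
    ultimately show ?thesis by blast
  qed
qed

section \<open>Weight and number of green parts\<close>

lemma sum_list_map_Suc: "sum_list (map Suc xs) = sum_list xs + length xs"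
  by (induction xs) auto

text \<open>The hooks partition the cells: the outer one takes \<open>2 * length as + 1\<close>
  cells of the square, \<open>a\<close> to its right and \<open>length bs\<close> below it.\<close>

lemma sum_list_hooks:
  "basis_pair as bs \<Longrightarrow> sum_list (map fst (hooks as bs)) = sum_list (assemble as bs)"
proof (induction as arbitrary: bs)
  case Nil
  then show ?case by (simp add: basis_pair_Nil assemble_def)
next
  case (Cons a as)
  note c = basis_pair_cases[OF Cons.prems]
  have "sum_list bs = sum_list (drop_column bs) + length (drop_column bs) + count_list bs 1"
    using arg_cong[OF c(4), of sum_list] by (simp add: sum_list_map_Suc sum_list_replicate)
  then show ?case
    using Cons.IH[OF c(1)] length_drop_column[OF Cons.prems]
    by (simp add: sum_list_assemble power2_eq_square)
qed

text \<open>Each distinct size of \<open>bs\<close> becomes 1 at exactly one stage of the column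
  removal and turns that hook green.\<close>

lemma green_hooks:
  "basis_pair as bs \<Longrightarrow> length (filter (\<lambda>p. snd p = Green) (hooks as bs)) = card (set bs)"
proof (induction as arbitrary: bs)
  case Nil
  then show ?case by (simp add: basis_pair_Nil)
next
  case (Cons a as)
  note c = basis_pair_cases[OF Cons.prems]
  have "set bs = Suc ` set (drop_column bs) \<union> (if 1 \<in> set bs then {1} else {})"
    using arg_cong[OF c(4), of set] count_list_0_iff[of bs 1]
    by (cases "1 \<in> set bs") (simp_all add: set_replicate_conv_if)
  then have "card (set bs) = card (Suc ` set (drop_column bs) \<union> (if 1 \<in> set bs then {1} else {}))"
    by (rule arg_cong)
  also have "\<dots> = card (set (drop_column bs)) + (if 1 \<in> set bs then 1 else 0)"
    using drop_column_pos[of bs] by (auto simp: card_insert_if card_image)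
  finally have "card (set bs) = card (set (drop_column bs)) + (if 1 \<in> set bs then 1 else 0)" .
  then show ?case
    using Cons.IH[OF c(1)] by simp
qed

lemma length_red_green:
  "length (filter (\<lambda>p. snd p = Red) ps) + length (filter (\<lambda>p. snd p = Green) ps) = length ps"
proof -
  have "(\<lambda>p. snd p = Green) = (\<lambda>p :: 'a \<times> color. \<not> snd p = Red)"
    using color.exhaust by (metis color.distinct(1))
  then show ?thesis
    by (simp add: sum_length_filter_compl)
qed

text \<open>There are \<open>length as\<close> hooks, \<open>card (set bs)\<close> of them green;
  the red count \<open>k\<close> is the difference.\<close>

lemma bij_betw_hooks:
  "bij_betw (\<lambda>(as, bs). hooks as bs)
     {(as, bs). basis_pair as bs \<and> length as = k + l \<and> card (set bs) = l \<and>
        sum_list (assemble as bs) = n}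
     {ps \<in> L2_set n. length (filter (\<lambda>p. snd p = Red) ps) = k \<and>
        length (filter (\<lambda>p. snd p = Green) ps) = l}"
  (is "bij_betw ?f ?A ?B")
proof (rule bij_betw_byWitness[where f' = unhooks])
  show "\<forall>x\<in>?A. unhooks (?f x) = x"
    using unhooks_hooks by auto
  show "\<forall>ps\<in>?B. ?f (unhooks ps) = ps"
    using unhooks_correct L2_set_iff_gapped by (auto split: prod.split)
  show "?f ` ?A \<subseteq> ?B"
  proof clarify
    fix as bs
    assume *: "basis_pair as bs" "length as = k + card (set bs)"
      and "n = sum_list (assemble as bs)" "l = card (set bs)"
    show "hooks as bs \<in> L2_set (sum_list (assemble as bs)) \<and>
        length (filter (\<lambda>p. snd p = Red) (hooks as bs)) = k \<and>
        length (filter (\<lambda>p. snd p = Green) (hooks as bs)) = card (set bs)"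
      using length_red_green[of "hooks as bs"] green_hooks[OF *(1)] *(2)
      by (simp add: L2_set_iff_gapped gapped_hooks sum_list_hooks *(1))
  qed
  show "unhooks ` ?B \<subseteq> ?A"
  proof (rule image_subsetI)
    fix ps assume ps: "ps \<in> ?B"
    obtain as bs where u: "unhooks ps = (as, bs)" by fastforce
    have *: "basis_pair as bs" "hooks as bs = ps"
      using unhooks_correct[OF _ u] ps L2_set_iff_gapped by auto
    show "unhooks ps \<in> ?A"
      using ps length_red_green[of ps] green_hooks[OF *(1)] sum_list_hooks[OF *(1)]
        length_hooks[of as bs] *
      by (simp add: u L2_set_iff_gapped)
  qed
qed

theorem theorem1p5:
  fixes n k l :: nat
  shows "card {lam \<in> basis_partitions n.
           durfee lam = k + l \<and> card (set (durfee_pi lam)) = l} = L2 n k l"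
  unfolding L2_def
  \<comment> \<open>Both sides count the same set of pairs \<open>(as, bs)\<close>.\<close>
  using bij_betw_same_card[OF bij_betw_assemble[of "k + l" l n]]
    bij_betw_same_card[OF bij_betw_hooks[of k l n]]
  by simp

end
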